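(* There is an absolute constant $C$ such that the following holds. Let $n\in\mathbb N$, $p\in(0,1)$, and let $G_1,G_2$ be two $3$-graphs on the common vertex set $[n]$ such that for some $\varepsilon\in(0,1]$ and all $I,J,K\subseteq[n]^2$, $$\Big|\sum_{(i,j,k)\in I^{(2,3)}\cap J^{(1,3)}\cap K^{(1,2)}}\big(A_{G_1}(i,j,k)-A_{G_2}(i,j,k)\big)\Big|\le \varepsilon p\Big(n^3p^3+np^2(|I|+|J|+|K|)+|I^{(2,3)}\cap J^{(1,3)}\cap K^{(1,2)}|\Big).$$ Assume further that for some $L\ge1$, $$t(H',G_1)\le L\,p^{e(H')}$$ for all proper sub-hypergraphs $H'\subset K_4^{(3)}$. Then $$|t(K_4^{(3)},G_1)-t(K_4^{(3)},G_2)|\le C\,\varepsilon L\,p^4.$$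
   Context: A $3$-graph is a finite simple $3$-uniform hypergraph; $K_4^{(3)}$ is the complete $3$-graph on $4$ vertices (all $4$ edges of size $3$). For a $3$-graph $G$ on $[n]$, $A_G:[n]^3\to\{0,1\}$ is its symmetric adjacency tensor: $A_G(i,j,k)=1$ iff $i,j,k$ are distinct and $\{i,j,k\}$ is an edge of $G$. For $I\subseteq[n]^2$ and $a,b\in\{1,2,3\}$, $I^{(a,b)}=\{(i_1,i_2,i_3)\in[n]^3:(i_a,i_b)\in I\}$. For a $3$-graph $H$ with vertex set $V(H)$, edge set $E(H)$, $e(H)=|E(H)|$, $$t(H,G)=n^{-|V(H)|}\sum_{\phi:V(H)\to[n]}\prod_{\{u,v,w\}\in E(H)}A_G(\phi(u),\phi(v),\phi(w)).$$ $H'$ is a proper sub-hypergraph of $H$ if $V(H')\subseteq V(H)$ and $E(H')$ is a strict subset of $E(H)$. *)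

theory Defs
  imports Complex_Main "HOL-Library.FuncSet"
begin

record 'a hypergraph =
  verts :: "'a set"
  edges :: "'a set set"

definition three_graph :: "'a hypergraph \<Rightarrow> bool" where
  "three_graph G \<longleftrightarrow> finite (verts G) \<and> (\<forall>e\<in>edges G. e \<subseteq> verts G \<and> card e = 3)"

definition three_graph_on :: "nat \<Rightarrow> nat hypergraph \<Rightarrow> bool" where
  "three_graph_on n G \<longleftrightarrow> three_graph G \<and> verts G = {1..n}"

definition K43 :: "nat hypergraph" where
  "K43 = \<lparr>verts = {1..4}, edges = {e. e \<subseteq> {1..4} \<and> card e = 3}\<rparr>"

definition proper_subhypergraph :: "'a hypergraph \<Rightarrow> 'a hypergraph \<Rightarrow> bool" where
  "proper_subhypergraph H' H \<longleftrightarrow>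
     three_graph H' \<and> verts H' \<subseteq> verts H \<and> edges H' \<subset> edges H"

definition adj :: "'a hypergraph \<Rightarrow> 'a \<Rightarrow> 'a \<Rightarrow> 'a \<Rightarrow> real" where
  "adj G i j k = (if distinct [i, j, k] \<and> {i, j, k} \<in> edges G then 1 else 0)"

lemma adj_swap12: "adj G j i k = adj G i j k"
  by (auto simp: adj_def insert_commute)

lemma adj_swap23: "adj G i k j = adj G i j k"
  by (auto simp: adj_def insert_commute)

(* The product over the edges {u,v,w} of H lists each edge exactly once, as the
   increasing triple u < v < w; the order is immaterial because adj is symmetric.
   Maps V(H) -> V(G) are represented by extensional functions. *)
definition hom_density :: "'a::linorder hypergraph \<Rightarrow> 'b hypergraph \<Rightarrow> real" where
  "hom_density H G =
     (\<Sum>\<phi> \<in> verts H \<rightarrow>\<^sub>E verts G.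
        \<Prod>(u, v, w) \<in> {(u, v, w). u < v \<and> v < w \<and> {u, v, w} \<in> edges H}.
          adj G (\<phi> u) (\<phi> v) (\<phi> w))
     / real (card (verts G)) ^ card (verts H)"

(* coordinates are numbered 1, 2, 3 *)
definition coord :: "nat \<Rightarrow> 'a \<times> 'a \<times> 'a \<Rightarrow> 'a" where
  "coord a = (\<lambda>(x, y, z). [x, y, z] ! (a - 1))"

definition lift_pairs :: "nat \<Rightarrow> nat \<Rightarrow> nat \<Rightarrow> (nat \<times> nat) set \<Rightarrow> (nat \<times> nat \<times> nat) set" where
  "lift_pairs n a b I =
     {x \<in> {1..n} \<times> {1..n} \<times> {1..n}. (coord a x, coord b x) \<in> I}"

end

theory Submission
  imports Defs
begin

text \<open>
  Fixing the vertices outside one edge of a pattern, the remaining edges restrict the coordinates of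
  that edge to sets \<open>I\<close>, \<open>J\<close>, \<open>K\<close> of pairs, so the cut hypothesis bounds the cost of replacing
  \<open>G\<^sub>1\<close> by \<open>G\<^sub>2\<close> on that edge by \<open>\<epsilon> p\<close> times a combination of edge densities and of the density of
  the pattern with the edge removed. All of these are needed for mixed patterns, in which some edges
  come from \<open>G\<^sub>1\<close> and others from \<open>G\<^sub>2\<close>. Since only patterns in \<open>G\<^sub>1\<close> are controlled by hypothesis, the
  same replacement argument is used to bound mixed patterns with one, two and three edges in turn;
  unconstrained pairs are handled by taking full sets. Each step is additive in the previous bounds,
  which keeps the result linear in \<open>L\<close>.
\<close>

section \<open>Sums over quadruples and their symmetries\<close>

definition sum4 :: "'v set \<Rightarrow> ('v \<Rightarrow> 'v \<Rightarrow> 'v \<Rightarrow> 'v \<Rightarrow> real) \<Rightarrow> real" where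
  "sum4 V F = (\<Sum>i\<in>V. \<Sum>j\<in>V. \<Sum>k\<in>V. \<Sum>l\<in>V. F i j k l)"

lemma sum4_swap12: "sum4 V (\<lambda>i j k l. F j i k l) = sum4 V F"
  unfolding sum4_def by (rule sum.swap)

lemma sum4_swap23: "sum4 V (\<lambda>i j k l. F i k j l) = sum4 V F"
  unfolding sum4_def by (intro sum.cong refl sum.swap)

lemma sum4_swap34: "sum4 V (\<lambda>i j k l. F i j l k) = sum4 V F"
  unfolding sum4_def by (intro sum.cong refl sum.swap)

lemma sum4_diff: "sum4 V (\<lambda>i j k l. F i j k l - H i j k l) = sum4 V F - sum4 V H"
  by (simp add: sum4_def sum_subtractf)

lemma sum4_const: "sum4 V (\<lambda>i j k l. c) = real (card V) ^ 4 * c"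
  by (simp add: sum4_def power_numeral_reduce)

lemma sum4_nonneg: "(\<And>i j k l. 0 \<le> F i j k l) \<Longrightarrow> 0 \<le> sum4 V F"
  by (simp add: sum4_def sum_nonneg)

text \<open>Three adjacent transpositions bring the last variable to the front. With
  \<open>l\<close> fixed, the inner triple sum has the shape to which the cut hypothesis
  applies.\<close>

lemma sum4_outer: "sum4 V F = (\<Sum>l\<in>V. \<Sum>i\<in>V. \<Sum>j\<in>V. \<Sum>k\<in>V. F i j k l)"
proof -
  have "sum4 V F = sum4 V (\<lambda>l i j k. F i j k l)"
    using sum4_swap12[of V "\<lambda>i j k l. F j k l i"] sum4_swap23[of V "\<lambda>i j k l. F i k l j"]
      sum4_swap34[of V F] by simp
  then show ?thesis
    by (simp add: sum4_def)
qed

text \<open>This permutation turns two edges that share the first two variables into two edges that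
  share the last two, up to symmetry of the tensors.\<close>

lemma sum4_rotate: "sum4 V (\<lambda>i j k l. F k l j i) = sum4 V F"
proof -
  have "sum4 V (\<lambda>i j k l. F k l j i) = sum4 V (\<lambda>i j k l. F k l i j)"
    by (rule sum4_swap12)
  also have "\<dots> = sum4 V (\<lambda>i j k l. F j l i k)"
    by (rule sum4_swap23)
  also have "\<dots> = sum4 V (\<lambda>i j k l. F j k i l)"
    by (rule sum4_swap34)
  also have "\<dots> = sum4 V (\<lambda>i j k l. F i k j l)"
    by (rule sum4_swap12)
  also have "\<dots> = sum4 V F"
    by (rule sum4_swap23)
  finally show ?thesis .
qed

section \<open>Indicators of sets of pairs and symmetric tensors\<close>

text \<open>Sets of pairs are encoded by their indicators, so that a link
  \<open>\<lambda>i j. a i j v\<close> of a tensor serves directly as such a set and intersections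
  become products.\<close>

definition binary :: "('v \<Rightarrow> 'v \<Rightarrow> real) \<Rightarrow> bool" where
  "binary x \<longleftrightarrow> (\<forall>i j. x i j \<in> {0, 1})"

text \<open>Two adjacent transpositions of the arguments generate full symmetry.\<close>

definition tensor :: "('v \<Rightarrow> 'v \<Rightarrow> 'v \<Rightarrow> real) \<Rightarrow> bool" where
  "tensor a \<longleftrightarrow>
     (\<forall>i j k. a i j k \<in> {0, 1} \<and> a j i k = a i j k \<and> a i k j = a i j k)"

lemma tensor_swaps:
  assumes "tensor a"
  shows "a j i k = a i j k" "a i k j = a i j k" "a k j i = a i j k"
  using assms unfolding tensor_def by metis+

lemma tensor_nonneg: "tensor a \<Longrightarrow> 0 \<le> a i j k"
  unfolding tensor_def by (metis insertE order_refl singletonD zero_le_one)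

lemma tensor_link_binary: "tensor a \<Longrightarrow> binary (\<lambda>i j. a i j v)"
  by (simp add: tensor_def binary_def)

section \<open>The cut hypothesis in functional form\<close>

text \<open>\<open>A\<close> and \<open>B\<close> stand for the two adjacency tensors. Denominators
  are cleared and every pattern is summed over four variables, so that \<open>card V ^ 4\<close> is
  the only normalisation. Patterns on the four vertices with equally many edges are isomorphic,
  since each edge is the complement of a vertex; hence one bound on \<open>A\<close> for each number
  of edges.\<close>

locale cut_close =
  fixes V :: "'v set" and p \<epsilon> L :: real and A B :: "'v \<Rightarrow> 'v \<Rightarrow> 'v \<Rightarrow> real"
  assumes p: "0 < p" "p \<le> 1" and \<epsilon>: "0 < \<epsilon>" "\<epsilon> \<le> 1" and L: "1 \<le> L"
    and tensor_A: "tensor A" and tensor_B: "tensor B"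
    and close: "\<And>x y z. binary x \<Longrightarrow> binary y \<Longrightarrow> binary z \<Longrightarrow>
      \<bar>\<Sum>i\<in>V. \<Sum>j\<in>V. \<Sum>k\<in>V. (A i j k - B i j k) * (x j k * y i k * z i j)\<bar>
      \<le> \<epsilon> * p * (real (card V) ^ 3 * p ^ 3
          + real (card V) * p\<^sup>2 * ((\<Sum>j\<in>V. \<Sum>k\<in>V. x j k) + (\<Sum>i\<in>V. \<Sum>k\<in>V. y i k)
                                   + (\<Sum>i\<in>V. \<Sum>j\<in>V. z i j))
          + (\<Sum>i\<in>V. \<Sum>j\<in>V. \<Sum>k\<in>V. x j k * y i k * z i j))"
    and edge_A: "sum4 V (\<lambda>i j k l. A i j k) \<le> L * p * real (card V) ^ 4"
    and two_A: "sum4 V (\<lambda>i j k l. A i j k * A i j l) \<le> L * p\<^sup>2 * real (card V) ^ 4"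
    and three_A: "sum4 V (\<lambda>i j k l. A j k l * A i k l * A i j l) \<le> L * p ^ 3 * real (card V) ^ 4"
begin

abbreviation N :: real where "N \<equiv> real (card V) ^ 4"

lemma tensor: "a \<in> {A, B} \<Longrightarrow> tensor a"
  using tensor_A tensor_B by auto

text \<open>For each fixed \<open>l\<close> the cut hypothesis is applied to the three sets of
  pairs, and the results are added over \<open>l\<close>. If \<open>a\<close> and \<open>a'\<close>
  agree, only nonnegativity of the right-hand side is at stake.\<close>

lemma cut_bound:
  assumes a: "a \<in> {A, B}" "a' \<in> {A, B}"
    and bin: "\<And>l. binary (\<lambda>j k. x j k l)" "\<And>l. binary (\<lambda>i k. y i k l)"
      "\<And>l. binary (\<lambda>i j. z i j l)"
  shows "\<bar>sum4 V (\<lambda>i j k l. a i j k * (x j k l * y i k l * z i j l))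
          - sum4 V (\<lambda>i j k l. a' i j k * (x j k l * y i k l * z i j l))\<bar>
    \<le> \<epsilon> * p * (N * p ^ 3
        + p\<^sup>2 * (sum4 V (\<lambda>i j k l. x j k l) + sum4 V (\<lambda>i j k l. y i k l)
                 + sum4 V (\<lambda>i j k l. z i j l))
        + sum4 V (\<lambda>i j k l. x j k l * y i k l * z i j l))" (is "\<bar>?S a - ?S a'\<bar> \<le> ?R")
proof -
  let ?c = "real (card V)"
  have nonneg: "0 \<le> x i j l" "0 \<le> y i j l" "0 \<le> z i j l" for i j l
    using bin unfolding binary_def by (metis insertE order_refl singletonD zero_le_one)+
  have R: "0 \<le> ?R"
    using p \<epsilon> by (intro mult_nonneg_nonneg add_nonneg_nonneg sum4_nonneg)
      (auto simp: nonneg)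
  have "\<bar>?S A - ?S B\<bar>
      = \<bar>\<Sum>l\<in>V. \<Sum>i\<in>V. \<Sum>j\<in>V. \<Sum>k\<in>V. (A i j k - B i j k) * (x j k l * y i k l * z i j l)\<bar>"
    unfolding sum4_diff[symmetric] sum4_outer by (simp add: left_diff_distrib sum_subtractf)
  also have "\<dots> \<le> (\<Sum>l\<in>V. \<epsilon> * p * (?c ^ 3 * p ^ 3
          + ?c * p\<^sup>2 * ((\<Sum>j\<in>V. \<Sum>k\<in>V. x j k l) + (\<Sum>i\<in>V. \<Sum>k\<in>V. y i k l)
                                   + (\<Sum>i\<in>V. \<Sum>j\<in>V. z i j l))
          + (\<Sum>i\<in>V. \<Sum>j\<in>V. \<Sum>k\<in>V. x j k l * y i k l * z i j l)))"
    by (rule order.trans[OF sum_abs sum_mono], rule close) (rule bin)+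
  also have "\<dots> = ?R"
  proof -
    \<comment> \<open>Each of \<open>x\<close>, \<open>y\<close>, \<open>z\<close> ignores one of
      \<open>i\<close>, \<open>j\<close>, \<open>k\<close>; the idle sum yields the factor
      \<open>card V\<close> that precedes \<open>p\<^sup>2\<close> in the cut hypothesis.\<close>
    have "sum4 V (\<lambda>i j k l. x j k l) = (\<Sum>l\<in>V. ?c * (\<Sum>j\<in>V. \<Sum>k\<in>V. x j k l))"
      "sum4 V (\<lambda>i j k l. y i k l) = (\<Sum>l\<in>V. ?c * (\<Sum>i\<in>V. \<Sum>k\<in>V. y i k l))"
      "sum4 V (\<lambda>i j k l. z i j l) = (\<Sum>l\<in>V. ?c * (\<Sum>i\<in>V. \<Sum>j\<in>V. z i j l))"
      by (simp_all add: sum4_outer sum_distrib_left)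
    moreover have "sum4 V (\<lambda>i j k l. x j k l * y i k l * z i j l)
        = (\<Sum>l\<in>V. \<Sum>i\<in>V. \<Sum>j\<in>V. \<Sum>k\<in>V. x j k l * y i k l * z i j l)"
      by (rule sum4_outer)
    moreover have "(\<Sum>l\<in>V. \<epsilon> * p * (?c ^ 3 * p ^ 3 + ?c * p\<^sup>2 * (X l + Y l + Z l) + T l))
        = \<epsilon> * p * (N * p ^ 3 + p\<^sup>2 * ((\<Sum>l\<in>V. ?c * X l) + (\<Sum>l\<in>V. ?c * Y l) + (\<Sum>l\<in>V. ?c * Z l))
            + (\<Sum>l\<in>V. T l))" for X Y Z T :: "'v \<Rightarrow> real"
    proof -
      have "N = ?c * ?c ^ 3"
        by (simp add: power_numeral_reduce)
      then show ?thesis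
        by (simp only: sum.distrib sum_distrib_left[symmetric] sum_constant)
          (simp add: algebra_simps)
    qed
    ultimately show ?thesis
      by simp
  qed
  finally have "\<bar>?S A - ?S B\<bar> \<le> ?R" .
  then show ?thesis
    using a R by (auto simp: abs_minus_commute)
qed

text \<open>The auxiliary bounds on mixed patterns give \<open>\<epsilon>\<close> away, using
  \<open>\<epsilon> \<le> 1\<close>.\<close>

lemma eps_mult_le: "c \<le> d \<Longrightarrow> 0 \<le> d \<Longrightarrow> \<epsilon> * c \<le> d"
proof (cases "0 \<le> c")
  case True
  then have "\<epsilon> * c \<le> c"
    using \<epsilon> by (simp add: mult_left_le_one_le)
  then show "c \<le> d \<Longrightarrow> \<epsilon> * c \<le> d" by simp
next
  case False
  then have "\<epsilon> * c \<le> 0"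
    using \<epsilon> by (simp add: mult_le_0_iff)
  then show "0 \<le> d \<Longrightarrow> \<epsilon> * c \<le> d" by simp
qed

lemma mult_N_mono: "q \<le> r \<Longrightarrow> q * N \<le> r * N"
  by (simp add: mult_right_mono)

text \<open>Surplus powers of \<open>p\<close> are dropped, so that all error terms become multiples
  of one quantity \<open>L * p ^ m * N\<close> and can be added linearly.\<close>

lemma power_le_L_mult: "m \<le> k \<Longrightarrow> p ^ k \<le> L * p ^ m"
proof -
  assume "m \<le> k"
  then have "p ^ k \<le> p ^ m"
    using p by (simp add: power_decreasing)
  also have "\<dots> \<le> L * p ^ m"
    using p L by simp
  finally show ?thesis .
qed

lemma power_mult_N_le: "m \<le> k \<Longrightarrow> p ^ k * N \<le> L * p ^ m * N"
  by (intro mult_N_mono power_le_L_mult)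

section \<open>Bounds for mixed patterns with one, two and three edges\<close>

text \<open>The edge is replaced with all three sets of pairs full. The error contributes 1 + 3 + 1
  = 5, the given bound for \<open>A\<close> contributes 1.\<close>

lemma edge_le:
  assumes "a \<in> {A, B}"
  shows "sum4 V (\<lambda>i j k l. a i j k) \<le> 6 * (L * p * N)"
proof -
  have one: "binary (\<lambda>i j. 1)" by (simp add: binary_def)
  have "\<bar>sum4 V (\<lambda>i j k l. a i j k) - sum4 V (\<lambda>i j k l. A i j k)\<bar>
      \<le> \<epsilon> * p * (N * p ^ 3 + p\<^sup>2 * (N + N + N) + N)"
    using cut_bound[OF assms, of A "\<lambda>i j l. 1" "\<lambda>i j l. 1" "\<lambda>i j l. 1"] one
    by (simp add: sum4_const)
  also have "\<dots> = \<epsilon> * (p ^ 4 * N + 3 * (p ^ 3 * N) + p ^ 1 * N)"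
    by (simp add: algebra_simps power_numeral_reduce)
  also have "\<dots> \<le> 5 * (L * p * N)"
  proof (rule eps_mult_le)
    show "p ^ 4 * N + 3 * (p ^ 3 * N) + p ^ 1 * N \<le> 5 * (L * p * N)"
      using power_mult_N_le[of 1 4] power_mult_N_le[of 1 3] power_mult_N_le[of 1 1] unfolding power_one_right
      by linarith
  qed (use p L in auto)
  finally show ?thesis
    using edge_A by linarith
qed

lemma edge_le':
  assumes "a \<in> {A, B}"
  shows "sum4 V (\<lambda>i j k l. a i j l) \<le> 6 * (L * p * N)"
    "sum4 V (\<lambda>i j k l. a i k l) \<le> 6 * (L * p * N)"
    "sum4 V (\<lambda>i j k l. a j k l) \<le> 6 * (L * p * N)"
proof -
  show 1: "sum4 V (\<lambda>i j k l. a i j l) \<le> 6 * (L * p * N)"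
    using edge_le[OF assms] by (simp add: sum4_swap34[of V "\<lambda>i j k l. a i j k"])
  then show 2: "sum4 V (\<lambda>i j k l. a i k l) \<le> 6 * (L * p * N)"
    by (simp add: sum4_swap23[of V "\<lambda>i j k l. a i j l"])
  then show "sum4 V (\<lambda>i j k l. a j k l) \<le> 6 * (L * p * N)"
    by (simp add: sum4_swap12[of V "\<lambda>i j k l. a i k l"])
qed

text \<open>The edge \<open>i j l\<close> restricts only the pair \<open>(i, j)\<close>, through its
  link at \<open>l\<close>; the other two sets of pairs are full.\<close>

lemma two_step:
  assumes "a \<in> {A, B}" "a' \<in> {A, B}" "b \<in> {A, B}"
  shows "\<bar>sum4 V (\<lambda>i j k l. a i j k * b i j l) - sum4 V (\<lambda>i j k l. a' i j k * b i j l)\<bar>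
      \<le> 15 * (L * p\<^sup>2 * N)"
proof -
  have one: "binary (\<lambda>i j. 1)" by (simp add: binary_def)
  let ?E = "sum4 V (\<lambda>i j k l. b i j l)"
  have "\<bar>sum4 V (\<lambda>i j k l. a i j k * b i j l) - sum4 V (\<lambda>i j k l. a' i j k * b i j l)\<bar>
      \<le> \<epsilon> * p * (N * p ^ 3 + p\<^sup>2 * (N + N + ?E) + ?E)"
    using cut_bound[OF assms(1,2), of "\<lambda>i j l. 1" "\<lambda>i j l. 1" b] one
      tensor_link_binary[OF tensor[OF assms(3)]]
    by (simp add: sum4_const)
  also have "\<dots> = \<epsilon> * (p ^ 4 * N + 2 * (p ^ 3 * N) + p ^ 3 * ?E + p * ?E)"
    by (simp add: algebra_simps power_numeral_reduce)
  \<comment> \<open>The four summands contribute 1, 2, 6 and 6.\<close>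
  also have "\<dots> \<le> 15 * (L * p\<^sup>2 * N)"
  proof (rule eps_mult_le)
    have E: "0 \<le> ?E"
      by (intro sum4_nonneg tensor_nonneg tensor assms)
    have "p ^ 3 * ?E \<le> p * ?E"
      using p power_decreasing[of 1 3 p] by (intro mult_right_mono E) auto
    moreover have "p * ?E \<le> p * (6 * (L * p * N))"
      using p edge_le'(1)[OF assms(3)] by (intro mult_left_mono) auto
    moreover have "p * (6 * (L * p * N)) = 6 * (L * p\<^sup>2 * N)"
      by (simp add: power2_eq_square)
    ultimately show "p ^ 4 * N + 2 * (p ^ 3 * N) + p ^ 3 * ?E + p * ?E \<le> 15 * (L * p\<^sup>2 * N)"
      using power_mult_N_le[of 2 4] power_mult_N_le[of 2 3] by linarith
  qed (use p L in auto)
  finally show ?thesis .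
qed

text \<open>Two replacements lead from both edges in \<open>A\<close> to the edges \<open>a\<close>
  and \<open>b\<close>, whence 1 + 15 + 15 = 31. Exchanging \<open>k\<close> and \<open>l\<close>
  moves the second edge into the slot treated by \<open>two_step\<close>.\<close>

lemma two_le:
  assumes "a \<in> {A, B}" "b \<in> {A, B}"
  shows "sum4 V (\<lambda>i j k l. a i j k * b i j l) \<le> 31 * (L * p\<^sup>2 * N)"
proof -
  have "sum4 V (\<lambda>i j k l. A i j k * b i j l) = sum4 V (\<lambda>i j k l. b i j k * A i j l)"
    using sum4_swap34[of V "\<lambda>i j k l. A i j k * b i j l"] by (simp add: mult.commute)
  then show ?thesis
    using two_step[of a A b] two_step[of b A A] two_A assms by auto
qed

text \<open>After exchanging \<open>k\<close> and \<open>l\<close> the edge to be replaced is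
  \<open>i j k\<close>. The links of the other two edges at \<open>l\<close> restrict
  \<open>(j, k)\<close> and \<open>(i, k)\<close>, while \<open>(i, j)\<close> stays free.\<close>

lemma three_step:
  assumes "a \<in> {A, B}" "a' \<in> {A, B}" "b \<in> {A, B}" "c \<in> {A, B}"
  shows "\<bar>sum4 V (\<lambda>i j k l. c j k l * b i k l * a i j l)
          - sum4 V (\<lambda>i j k l. c j k l * b i k l * a' i j l)\<bar> \<le> 45 * (L * p ^ 3 * N)"
proof -
  note sym = tensor_swaps[OF tensor]
  have one: "binary (\<lambda>i j. 1)" by (simp add: binary_def)
  let ?E = "\<lambda>b. sum4 V (\<lambda>i j k l. b i k l)" and ?T = "sum4 V (\<lambda>i j k l. c j k l * b i k l)"
  have Ec: "sum4 V (\<lambda>i j k l. c j k l) = ?E c"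
    by (rule sum4_swap12)
  \<comment> \<open>Removing the edge leaves two edges that share \<open>k\<close> and
    \<open>l\<close>; a permutation gives them the form required by \<open>two_le\<close>.\<close>
  have T: "?T = sum4 V (\<lambda>i j k l. c i j k * b i j l)"
    using sum4_rotate[of V "\<lambda>i j k l. c i j k * b i j l"]
    by (simp add: sym[OF assms(4)] sym[OF assms(3)])
  have swap: "sum4 V (\<lambda>i j k l. c j k l * b i k l * d i j l)
      = sum4 V (\<lambda>i j k l. d i j k * (c j k l * b i k l * 1))" if "d \<in> {A, B}" for d
    using sum4_swap34[of V "\<lambda>i j k l. c j k l * b i k l * d i j l"]
    by (simp add: sym[OF assms(3)] sym[OF assms(4)] mult_ac)
  have "\<bar>sum4 V (\<lambda>i j k l. c j k l * b i k l * a i j l)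
          - sum4 V (\<lambda>i j k l. c j k l * b i k l * a' i j l)\<bar>
      \<le> \<epsilon> * p * (N * p ^ 3 + p\<^sup>2 * (?E c + ?E b + N) + ?T)"
    unfolding swap[OF assms(1)] swap[OF assms(2)]
    using cut_bound[OF assms(1,2), of c b "\<lambda>i j l. 1"] one
      tensor_link_binary[OF tensor[OF assms(3)]] tensor_link_binary[OF tensor[OF assms(4)]]
    by (simp add: sum4_const Ec)
  also have "\<dots> = \<epsilon> * (p ^ 4 * N + p ^ 3 * N + p ^ 3 * ?E c + p ^ 3 * ?E b + p * ?T)"
    by (simp add: algebra_simps power_numeral_reduce)
  \<comment> \<open>The five summands contribute 1, 1, 6, 6 and 31.\<close>
  also have "\<dots> \<le> 45 * (L * p ^ 3 * N)"
  proof (rule eps_mult_le)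
    have "p ^ 3 * ?E d \<le> 6 * (L * p ^ 3 * N)" if "d \<in> {A, B}" for d
    proof -
      have "p ^ 3 * ?E d \<le> p ^ 3 * (6 * (L * p * N))"
        using p edge_le'(2)[OF that] by (intro mult_left_mono) auto
      also have "\<dots> = p ^ 4 * (6 * (L * N))"
        by (simp add: power_numeral_reduce)
      also have "\<dots> \<le> p ^ 3 * (6 * (L * N))"
        using p L by (intro mult_right_mono power_decreasing) auto
      finally show ?thesis by (simp add: mult_ac)
    qed
    from this[OF assms(3)] this[OF assms(4)]
    have "p ^ 3 * ?E b \<le> 6 * (L * p ^ 3 * N)" "p ^ 3 * ?E c \<le> 6 * (L * p ^ 3 * N)" .
    moreover have "p * ?T \<le> p * (31 * (L * p\<^sup>2 * N))"
      using p two_le[OF assms(4,3)] unfolding T by (intro mult_left_mono) auto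
    moreover have "p * (31 * (L * p\<^sup>2 * N)) = 31 * (L * p ^ 3 * N)"
      by (simp add: power_numeral_reduce)
    ultimately show "p ^ 4 * N + p ^ 3 * N + p ^ 3 * ?E c + p ^ 3 * ?E b + p * ?T
        \<le> 45 * (L * p ^ 3 * N)"
      using power_mult_N_le[of 3 4] power_mult_N_le[of 3 3] by linarith
  qed (use p L in auto)
  finally show ?thesis .
qed

text \<open>Starting from \<open>A\<close> in all slots, one edge at a time is replaced in the last
  slot; permuting the vertices moves any of the three edges there. This gives 1 + 3 * 45 =
  136.\<close>

lemma three_le:
  assumes a: "a \<in> {A, B}" and b: "b \<in> {A, B}" and c: "c \<in> {A, B}"
  shows "sum4 V (\<lambda>i j k l. c j k l * b i k l * a i j l) \<le> 136 * (L * p ^ 3 * N)"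
proof -
  let ?P = "\<lambda>c b a. sum4 V (\<lambda>i j k l. c j k l * b i k l * a i j l)"
  have A: "A \<in> {A, B}" by simp
  have swap1: "?P c b a = ?P b c a" if "a \<in> {A, B}" for a b c
    using sum4_swap12[of V "\<lambda>i j k l. b j k l * c i k l * a i j l"]
    by (simp add: tensor_swaps[OF tensor[OF that]] mult_ac)
  have swap2: "?P c b a = ?P c a b" if "c \<in> {A, B}" for a b c
    using sum4_swap23[of V "\<lambda>i j k l. c j k l * a i k l * b i j l"]
    by (simp add: tensor_swaps[OF tensor[OF that]] mult_ac)
  have "?P A A d \<le> 46 * (L * p ^ 3 * N)" if "d \<in> {A, B}" for d
    using three_step[OF that A A A] three_A by linarith
  then have "?P A d e \<le> 91 * (L * p ^ 3 * N)" if "d \<in> {A, B}" "e \<in> {A, B}" for d e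
    using three_step[OF that(2) A that(1) A] swap2[OF A, of d A] that by force
  then have "?P A b a \<le> 91 * (L * p ^ 3 * N)"
    using a b by blast
  \<comment> \<open>Reversing the three slots, as a product of adjacent transpositions, brings the
    remaining \<open>A\<close> to the last slot.\<close>
  moreover have "?P a b A = ?P A b a"
    by (simp only: swap1[OF A, of a b] swap2[OF b, of a A] swap1[OF a, of b A])
  moreover have "?P c b a = ?P a b c"
    by (simp only: swap1[OF a, of c b] swap2[OF b, of c a] swap1[OF c, of b a])
  ultimately show ?thesis
    using three_step[OF c A b a] by linarith
qed

section \<open>Replacing all four edges\<close>

text \<open>Here \<open>\<epsilon>\<close> is kept. The previous bounds enter additively, so the
  error stays linear in \<open>L\<close>. The constant is 155 = 1 + 18 + 136, from the constant
  term, the three edge sums and the three-edge pattern.\<close>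

lemma four_step:
  assumes a: "a \<in> {A, B}" and b: "b \<in> {A, B}" and c: "c \<in> {A, B}"
  shows "\<bar>sum4 V (\<lambda>i j k l. A i j k * (c j k l * b i k l * a i j l))
          - sum4 V (\<lambda>i j k l. B i j k * (c j k l * b i k l * a i j l))\<bar>
      \<le> 155 * (\<epsilon> * L * p ^ 4 * N)"
proof -
  let ?T = "sum4 V (\<lambda>i j k l. c j k l * b i k l * a i j l)"
    and ?E = "sum4 V (\<lambda>i j k l. c j k l) + sum4 V (\<lambda>i j k l. b i k l)
      + sum4 V (\<lambda>i j k l. a i j l)"
  have "p\<^sup>2 * ?E \<le> p\<^sup>2 * (18 * (L * p * N))"
    using edge_le'(3)[OF c] edge_le'(2)[OF b] edge_le'(1)[OF a]
    by (intro mult_left_mono) auto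
  also have "\<dots> = 18 * (L * p ^ 3 * N)"
    by (simp add: power_numeral_reduce)
  finally have "N * p ^ 3 + p\<^sup>2 * ?E + ?T \<le> 155 * (L * p ^ 3 * N)"
    using three_le[OF a b c] power_mult_N_le[of 3 3] by (simp add: mult.commute[of N])
  then have "\<epsilon> * p * (N * p ^ 3 + p\<^sup>2 * ?E + ?T) \<le> \<epsilon> * p * (155 * (L * p ^ 3 * N))"
    using \<epsilon> p by (intro mult_left_mono) auto
  also have "\<dots> = 155 * (\<epsilon> * L * p ^ 4 * N)"
    by (simp add: power_numeral_reduce)
  finally show ?thesis
    using cut_bound[of A B c b a] tensor_link_binary[OF tensor] a b c by fastforce
qed

text \<open>Telescoping through patterns with 0, 1, 2, 3 and 4 edges in \<open>B\<close> takes four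
  replacements, whence 620 = 4 * 155.\<close>

lemma four_diff:
  "\<bar>sum4 V (\<lambda>i j k l. A i j k * (A j k l * A i k l * A i j l))
    - sum4 V (\<lambda>i j k l. B i j k * (B j k l * B i k l * B i j l))\<bar>
      \<le> 620 * (\<epsilon> * L * p ^ 4 * N)"
proof -
  let ?Q = "\<lambda>d c b a. sum4 V (\<lambda>i j k l. d i j k * (c j k l * b i k l * a i j l))"
  note sym = tensor_swaps[OF tensor_A] tensor_swaps[OF tensor_B]
  \<comment> \<open>After each replacement the new \<open>B\<close> stands in the first slot; vertex
    symmetries bring an edge \<open>A\<close> back there for the next one.\<close>
  have swap12: "?Q B A B B = ?Q B B A B"
    using sum4_swap12[of V "\<lambda>i j k l. B i j k * (B j k l * A i k l * B i j l)"]
    by (simp add: sym mult_ac)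
  have swap23: "?Q B A A B = ?Q B A B A" "?Q B B A B = ?Q B B B A"
    using sum4_swap23[of V "\<lambda>i j k l. B i j k * (A j k l * B i k l * A i j l)"]
      sum4_swap23[of V "\<lambda>i j k l. B i j k * (B j k l * B i k l * A i j l)"]
    by (simp_all add: sym mult_ac)
  have swap34: "?Q B A A A = ?Q A A A B" "?Q B A B A = ?Q A A B B" "?Q B B B A = ?Q A B B B"
    using sum4_swap34[of V "\<lambda>i j k l. A i j k * (A j k l * A i k l * B i j l)"]
      sum4_swap34[of V "\<lambda>i j k l. A i j k * (A j k l * B i k l * B i j l)"]
      sum4_swap34[of V "\<lambda>i j k l. A i j k * (B j k l * B i k l * B i j l)"]
    by (simp_all add: sym mult_ac)
  show ?thesis
    using four_step[of A A A] four_step[of B A A] four_step[of B B A] four_step[of B B B]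
      swap12 swap23 swap34 by simp
qed

end

section \<open>From hypergraph densities and sets of pairs to sums\<close>

lemma sum_PiE_four:
  "(\<Sum>\<phi>\<in>{1..4::nat} \<rightarrow>\<^sub>E V. F (\<phi> 1) (\<phi> 2) (\<phi> 3) (\<phi> 4)) = sum4 V F"
proof -
  have upto: "{1..4::nat} = {1, 2, 3, 4}" by auto
  have "(\<Sum>\<phi>\<in>{1..4::nat} \<rightarrow>\<^sub>E V. F (\<phi> 1) (\<phi> 2) (\<phi> 3) (\<phi> 4))
      = (\<Sum>(i, j, k, l)\<in>V \<times> V \<times> V \<times> V. F i j k l)"
    unfolding upto
    \<comment> \<open>Outside \<open>{1..4}\<close> the inverse map takes the value
      \<open>undefined\<close>, as extensionality requires.\<close>
    by (rule sum.reindex_bij_witness[where i = "\<lambda>(i, j, k, l) x. if x = 1 then i else if x = 2 then j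
            else if x = 3 then k else if x = 4 then l else undefined"
          and j = "\<lambda>\<phi>. (\<phi> 1, \<phi> 2, \<phi> 3, \<phi> 4)"])
      (auto simp: fun_eq_iff PiE_iff extensional_def)
  then show ?thesis
    by (simp add: sum4_def sum.cartesian_product)
qed

text \<open>Only four increasing triples fit into \<open>{1..4}\<close>. An absent edge becomes a
  factor 1, so that one formula serves all patterns on four vertices.\<close>

lemma hom_density_four:
  assumes V: "verts H = {1..4::nat}" and E: "edges H \<subseteq> Pow {1..4}"
  shows "hom_density H G
    = sum4 (verts G) (\<lambda>i j k l. (if {1, 2, 3} \<in> edges H then adj G i j k else 1)
        * (if {1, 2, 4} \<in> edges H then adj G i j l else 1)
        * (if {1, 3, 4} \<in> edges H then adj G i k l else 1)
        * (if {2, 3, 4} \<in> edges H then adj G j k l else 1))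
      / real (card (verts G)) ^ 4" (is "_ = sum4 _ ?F / _")
proof -
  let ?T = "{(1, 2, 3), (1, 2, 4), (1, 3, 4), (2, 3, 4)} :: (nat \<times> nat \<times> nat) set"
  have triples: "{(u, v, w). u < v \<and> v < w \<and> {u, v, w} \<in> edges H}
      = {t \<in> ?T. case t of (u, v, w) \<Rightarrow> {u, v, w} \<in> edges H}"
  proof -
    have "(u, v, w) \<in> ?T" if "u < v" "v < w" "{u, v, w} \<in> edges H" for u v w
    proof -
      have "1 \<le> u" "w \<le> 4" using that E by auto
      then have "u = 1 \<or> u = 2" "v = 2 \<or> v = 3" "w = 3 \<or> w = 4"
        using that by auto
      then show ?thesis using that by auto
    qed
    then show ?thesis by auto
  qed
  have prod: "(\<Prod>(u, v, w)\<in>{(u, v, w). u < v \<and> v < w \<and> {u, v, w} \<in> edges H}.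
      adj G (\<phi> u) (\<phi> v) (\<phi> w)) = ?F (\<phi> 1) (\<phi> 2) (\<phi> 3) (\<phi> 4)" for \<phi>
    unfolding triples by (subst prod.inter_filter) (simp_all add: mult.assoc)
  show ?thesis
    unfolding hom_density_def V prod sum_PiE_four[of ?F] by simp
qed

text \<open>The indicator of an intersection is the product of the indicators; \<open>S\<close>
  recovers a set of pairs from its indicator. This carries the cut hypothesis from sets over to
  functions.\<close>

lemma sum_lift_pairs:
  fixes n :: nat and x y z :: "nat \<Rightarrow> nat \<Rightarrow> real"
  assumes "binary x" "binary y" "binary z"
  defines "S \<equiv> \<lambda>x::nat \<Rightarrow> nat \<Rightarrow> real. {(u, v) \<in> {1..n} \<times> {1..n}. x u v = 1}"
  shows "(\<Sum>(i, j, k)\<in>lift_pairs n 2 3 (S x) \<inter> lift_pairs n 1 3 (S y) \<inter> lift_pairs n 1 2 (S z). f i j k)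
    = (\<Sum>i\<in>{1..n}. \<Sum>j\<in>{1..n}. \<Sum>k\<in>{1..n}. f i j k * (x j k * y i k * z i j))"
proof -
  let ?V = "{1..n}"
  have "lift_pairs n 2 3 (S x) \<inter> lift_pairs n 1 3 (S y) \<inter> lift_pairs n 1 2 (S z)
      = {t \<in> ?V \<times> ?V \<times> ?V. case t of (i, j, k) \<Rightarrow> x j k = 1 \<and> y i k = 1 \<and> z i j = 1}"
    by (auto simp: lift_pairs_def coord_def S_def)
  moreover have "(if x j k = 1 \<and> y i k = 1 \<and> z i j = 1 then f i j k else 0)
      = f i j k * (x j k * y i k * z i j)" for i j k
    using assms(1-3) unfolding binary_def
    by (metis insertE mult_1 mult_1_right mult_zero_left mult_zero_right singletonD)
  ultimately show ?thesis
    by (simp add: sum.inter_filter sum.cartesian_product case_prod_unfold)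
qed

lemma card_support:
  fixes x :: "nat \<Rightarrow> nat \<Rightarrow> real"
  assumes "binary x"
  shows "real (card {(u, v) \<in> {1..n} \<times> {1..n}. x u v = 1}) = (\<Sum>u\<in>{1..n}. \<Sum>v\<in>{1..n}. x u v)"
proof -
  have "(if x u v = 1 then 1 else 0) = x u v" for u v
    using assms by (auto simp: binary_def)
  moreover have "real (card {t \<in> {1..n} \<times> {1..n}. x (fst t) (snd t) = 1})
      = (\<Sum>t\<in>{1..n} \<times> {1..n}. if x (fst t) (snd t) = 1 then 1 else 0)"
    by (subst sum.inter_filter[symmetric]) auto
  moreover have "{(u, v) \<in> {1..n} \<times> {1..n}. x u v = 1} = {t \<in> {1..n} \<times> {1..n}. x (fst t) (snd t) = 1}"
    by auto
  ultimately show ?thesis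
    by (simp add: sum.cartesian_product case_prod_unfold)
qed

lemma tensor_adj: "tensor (adj G)"
  unfolding tensor_def by (intro allI conjI adj_swap12 adj_swap23) (simp add: adj_def)

text \<open>The pattern is taken on all four vertices, isolated ones included, so that its density
  is normalised by the fourth power of \<open>n\<close>. The missing edge \<open>e\<close> makes the
  inclusion of edge sets strict.\<close>

lemma sub_K43_bound:
  assumes G: "three_graph_on n G"
    and sub: "\<forall>H'. proper_subhypergraph H' K43 \<longrightarrow> hom_density H' G \<le> L * p ^ card (edges H')"
    and E: "E \<subseteq> edges K43" "e \<in> edges K43" "e \<notin> E"
  shows "sum4 {1..n} (\<lambda>i j k l. (if {1, 2, 3} \<in> E then adj G i j k else 1)
        * (if {1, 2, 4} \<in> E then adj G i j l else 1)
        * (if {1, 3, 4} \<in> E then adj G i k l else 1)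
        * (if {2, 3, 4} \<in> E then adj G j k l else 1)) \<le> L * p ^ card E * real (card {1..n}) ^ 4"
proof (cases "n = 0")
  case False
  let ?H = "\<lparr>verts = {1..4::nat}, edges = E\<rparr>"
  have "hom_density ?H G \<le> L * p ^ card (edges ?H)"
    using E by (intro sub[rule_format]) (auto simp: proper_subhypergraph_def three_graph_def K43_def)
  moreover have "edges ?H \<subseteq> Pow {1..4}"
    using E by (auto simp: K43_def)
  ultimately show ?thesis
    using False G by (simp add: hom_density_four three_graph_on_def pos_divide_le_eq)
qed (simp add: sum4_def)

lemma K43_density:
  assumes "three_graph_on n G"
  shows "hom_density K43 G
    = sum4 {1..n} (\<lambda>i j k l. adj G i j k * (adj G j k l * adj G i k l * adj G i j l)) / real n ^ 4"
  using assms hom_density_four[of K43 G] by (simp add: K43_def three_graph_on_def mult_ac Pow_def subset_eq)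

section \<open>The counting estimate for two 3-graphs\<close>

theorem theorem1p5:
  "\<exists>C::real. \<forall>(n::nat) (p::real) (\<epsilon>::real) (L::real) (G1::nat hypergraph) (G2::nat hypergraph).
     0 < p \<longrightarrow> p < 1 \<longrightarrow> 0 < \<epsilon> \<longrightarrow> \<epsilon> \<le> 1 \<longrightarrow> 1 \<le> L \<longrightarrow>
     three_graph_on n G1 \<longrightarrow> three_graph_on n G2 \<longrightarrow>
     (\<forall>I J K. I \<subseteq> {1..n} \<times> {1..n} \<longrightarrow> J \<subseteq> {1..n} \<times> {1..n} \<longrightarrow> K \<subseteq> {1..n} \<times> {1..n} \<longrightarrow>
        \<bar>\<Sum>(i, j, k) \<in> lift_pairs n 2 3 I \<inter> lift_pairs n 1 3 J \<inter> lift_pairs n 1 2 K.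
            adj G1 i j k - adj G2 i j k\<bar>
        \<le> \<epsilon> * p * (real n ^ 3 * p ^ 3
              + real n * p ^ 2 * (real (card I) + real (card J) + real (card K))
              + real (card (lift_pairs n 2 3 I \<inter> lift_pairs n 1 3 J \<inter> lift_pairs n 1 2 K)))) \<longrightarrow>
     (\<forall>H'. proper_subhypergraph H' K43 \<longrightarrow> hom_density H' G1 \<le> L * p ^ card (edges H')) \<longrightarrow>
     \<bar>hom_density K43 G1 - hom_density K43 G2\<bar> \<le> C * \<epsilon> * L * p ^ 4"
\<comment> \<open>The constant is that of \<open>four_diff\<close>.\<close>
proof (intro exI[of _ 620] allI impI, goal_cases)
  case (1 n p \<epsilon> L G1 G2)
  note G = 1(6,7) and cut = 1(8) and sub = 1(9)
  let ?V = "{1..n}"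
  have K43_edges: "{1, 2, 3} \<in> edges K43" "{1, 2, 4} \<in> edges K43" "{1, 3, 4} \<in> edges K43"
      "{2, 3, 4} \<in> edges K43"
    by (auto simp: K43_def)
  interpret cut_close ?V p \<epsilon> L "adj G1" "adj G2"
  proof
    show "0 < p" "p \<le> 1" "0 < \<epsilon>" "\<epsilon> \<le> 1" "1 \<le> L"
      using 1 by auto
    show "tensor (adj G1)" "tensor (adj G2)"
      by (rule tensor_adj)+
  next
    fix x y z :: "nat \<Rightarrow> nat \<Rightarrow> real"
    assume bin: "binary x" "binary y" "binary z"
    let ?S = "\<lambda>x::nat \<Rightarrow> nat \<Rightarrow> real. {(u, v) \<in> ?V \<times> ?V. x u v = 1}"
    let ?M = "lift_pairs n 2 3 (?S x) \<inter> lift_pairs n 1 3 (?S y) \<inter> lift_pairs n 1 2 (?S z)"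
    have "real (card ?M) = (\<Sum>(i, j, k)\<in>?M. 1)"
      by (simp add: case_prod_unfold)
    also have "\<dots> = (\<Sum>i\<in>?V. \<Sum>j\<in>?V. \<Sum>k\<in>?V. x j k * y i k * z i j)"
      using sum_lift_pairs[OF bin, where n = n and f = "\<lambda>_ _ _. 1"] by simp
    finally have M: "real (card ?M) = \<dots>" .
    have "?S x \<subseteq> ?V \<times> ?V" "?S y \<subseteq> ?V \<times> ?V" "?S z \<subseteq> ?V \<times> ?V"
      by auto
    from cut[rule_format, OF this]
    show "\<bar>\<Sum>i\<in>?V. \<Sum>j\<in>?V. \<Sum>k\<in>?V. (adj G1 i j k - adj G2 i j k) * (x j k * y i k * z i j)\<bar>
      \<le> \<epsilon> * p * (real (card ?V) ^ 3 * p ^ 3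
          + real (card ?V) * p\<^sup>2 * ((\<Sum>j\<in>?V. \<Sum>k\<in>?V. x j k) + (\<Sum>i\<in>?V. \<Sum>k\<in>?V. y i k)
                                   + (\<Sum>i\<in>?V. \<Sum>j\<in>?V. z i j))
          + (\<Sum>i\<in>?V. \<Sum>j\<in>?V. \<Sum>k\<in>?V. x j k * y i k * z i j))"
      unfolding sum_lift_pairs[OF bin] M card_support[OF bin(1)] card_support[OF bin(2)]
        card_support[OF bin(3)] by simp
  next
    note bound = sub_K43_bound[OF G(1) sub]
    show "sum4 ?V (\<lambda>i j k l. adj G1 i j k) \<le> L * p * real (card ?V) ^ 4"
      using bound[OF _ K43_edges(4), of "{{1, 2, 3}}"] K43_edges
      by (simp add: set_eq_subset)
    show "sum4 ?V (\<lambda>i j k l. adj G1 i j k * adj G1 i j l) \<le> L * p\<^sup>2 * real (card ?V) ^ 4"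
      using bound[OF _ K43_edges(4), of "{{1, 2, 3}, {1, 2, 4}}"] K43_edges
      by (simp add: set_eq_subset power2_eq_square)
    \<comment> \<open>These are the three edges through vertex 4; the missing edge is
      \<open>{1, 2, 3}\<close>.\<close>
    show "sum4 ?V (\<lambda>i j k l. adj G1 j k l * adj G1 i k l * adj G1 i j l)
        \<le> L * p ^ 3 * real (card ?V) ^ 4"
      using bound[OF _ K43_edges(1), of "{{1, 2, 4}, {1, 3, 4}, {2, 3, 4}}"] K43_edges
      by (simp add: set_eq_subset mult_ac power_numeral_reduce)
  qed
  show ?case
  proof (cases "n = 0")
    \<comment> \<open>Both densities are quotients by zero and hence 0.\<close>
    case True
    then show ?thesis
      using 1 by (simp add: K43_density)
  next
    case False
    then show ?thesis
      using four_diff unfolding K43_density[OF G(1)] K43_density[OF G(2)] diff_divide_distrib[symmetric]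
      by (simp add: abs_divide pos_divide_le_eq mult_ac)
  qed
qed

end
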